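(* Let $d\ge 1$, let $I_1,\dots,I_d\subset\mathbb R$ be intervals (bounded or unbounded), $\mathbf I=I_1\times\dots\times I_d$, and let $\mathbf n=(n_1,\dots,n_d)\in\mathbb N^d$. Then a function $f\colon\mathbf I\to\mathbb R$ is box-$\mathbf n$-affine if and only if it is a pseudo-polynomial of degree $(n_1-1,n_2-1,\dots,n_d-1)$.
   Context: $\mathbb N=\{0,1,2,\dots\}$. Divided differences: for a real function $g$ of one variable and pairwise distinct points, $[x_0;g]=g(x_0)$ and $[x_0,\dots,x_n;g]=\dfrac{[x_1,\dots,x_n;g]-[x_0,\dots,x_{n-1};g]}{x_n-x_0}$ for $n\ge1$. Multiple divided differences: for $f\colon\mathbf I\to\mathbb R$, $\mathbf n\in\mathbb N^d$, and vectors $\mathbf x_i=(x_{i0},\dots,x_{in_i})\in I_i^{n_i+1}$ with pairwise distinct coordinates ($i=1,\dots,d$), the multiple divided difference $[\mathbf x_1;\dots;\mathbf x_d;f]$ of order $\mathbf n$ is defined by induction on $d$: for $d=1$ it is $[x_{10},\dots,x_{1n_1};f]$; for $d>1$ it is $[x_{d0},\dots,x_{dn_d};g]$, where $g(x)=[\mathbf x_1;\dots;\mathbf x_{d-1};f(\cdot,\dots,\cdot,x)]$ for $x\in I_d$. $f$ is box-$\mathbf n$-affine if $[\mathbf x_1;\dots;\mathbf x_d;f]=0$ for all such $\mathbf x_1,\dots,\mathbf x_d$. Pseudo-polynomials: for $\mathbf m=(m_1,\dots,m_d)\in\{-1,0,1,\dots\}^d$, a function $W\colon\mathbf I\to\mathbb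 R$ is a pseudo-polynomial of degree $\mathbf m$ if $W(x_1,\dots,x_d)=\sum_{i=1}^d\sum_{k=0}^{m_i}A_{ik}(x_1,\dots,x_{i-1},x_{i+1},\dots,x_d)\,x_i^k$, where $A_{ik}\colon\prod_{j\ne i}I_j\to\mathbb R$ are arbitrary functions (the inner sum is $0$ if $m_i=-1$; if $d=1$ the $A_{ik}$ are constants). *)

theory Defs
  imports "HOL-Analysis.Analysis"
begin

fun divdiff :: "real list \<Rightarrow> (real \<Rightarrow> real) \<Rightarrow> real" where
  "divdiff [] g = 0"  (* junk value *)
| "divdiff [x] g = g x"
| "divdiff (x # y # zs) g =
     (divdiff (y # zs) g - divdiff (butlast (x # y # zs)) g) / (last (y # zs) - x)"

(* A point of I_1 x ... x I_d is an element of PiE {1..d} I, i.e. a function on nat that is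
   undefined outside {1..d}.  Accordingly, f(.,...,.,x) is f with the last coordinate set to x by
   function update.  The recursion starts at the degenerate d = 0, where the only point is
   (%_. undefined); for d = 1 it yields the one-dimensional divided difference of f. *)
primrec multi_divdiff ::
  "nat \<Rightarrow> (nat \<Rightarrow> real list) \<Rightarrow> ((nat \<Rightarrow> real) \<Rightarrow> real) \<Rightarrow> real" where
  "multi_divdiff 0 X f = f (\<lambda>_. undefined)"
| "multi_divdiff (Suc d) X f =
     divdiff (X (Suc d)) (\<lambda>x. multi_divdiff d X (\<lambda>y. f (y(Suc d := x))))"

definition box_affine ::
  "nat \<Rightarrow> (nat \<Rightarrow> real set) \<Rightarrow> (nat \<Rightarrow> nat) \<Rightarrow> ((nat \<Rightarrow> real) \<Rightarrow> real) \<Rightarrow> bool" where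
  "box_affine d I n f \<longleftrightarrow>
     (\<forall>X. (\<forall>i\<in>{1..d}. length (X i) = n i + 1 \<and> distinct (X i) \<and> set (X i) \<subseteq> I i)
          \<longrightarrow> multi_divdiff d X f = 0)"

(* Degrees are integers so that m i = -1 makes the inner sum empty.  The coefficient A i k sees x
   only through its restriction to the coordinates other than i, so it does not depend on x i (and
   contributes a constant when d = 1). *)
definition pseudo_polynomial ::
  "nat \<Rightarrow> (nat \<Rightarrow> real set) \<Rightarrow> (nat \<Rightarrow> int) \<Rightarrow> ((nat \<Rightarrow> real) \<Rightarrow> real) \<Rightarrow> bool" where
  "pseudo_polynomial d I m W \<longleftrightarrow>
     (\<exists>A :: nat \<Rightarrow> nat \<Rightarrow> (nat \<Rightarrow> real) \<Rightarrow> real. \<forall>x \<in> PiE {1..d} I.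
        W x = (\<Sum>i = 1..d. \<Sum>k | int k \<le> m i. A i k (restrict x ({1..d} - {i})) * x i ^ k))"

end

(* Expanding a divided difference as a weighted sum of values, with x among the nodes, expresses
   g x as the Lagrange interpolant of g on the other nodes plus a multiple of the divided
   difference.  If f is box-n-affine in d + 1 variables, apply this in the last variable with n(d+1)
   fixed nodes: the interpolant is a polynomial of degree n(d+1) - 1 in the last variable, and the
   remainder is, for each fixed last coordinate, box-n-affine in the other d variables, so induction
   applies.  Conversely, each summand of a pseudo-polynomial is killed by the divided difference in
   one of the variables.  If the last interval has fewer than n(d+1) points, all of them are taken as
   nodes and the interpolation is exact. *)
theory Submission
  imports Defs
begin

section \<open>Divided differences in one variable\<close>

lemma divdiff_cong:
  "(\<And>x. x \<in> set xs \<Longrightarrow> g x = h x) \<Longrightarrow> divdiff xs g = divdiff xs h"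
proof (induction xs g rule: divdiff.induct)
  case (3 x y zs g)
  have "divdiff (y # zs) g = divdiff (y # zs) h"
    by (rule 3) (use 3 in auto)
  moreover have "divdiff (butlast (x # y # zs)) g = divdiff (butlast (x # y # zs)) h"
    by (rule 3) (use 3 in \<open>auto dest: in_set_butlastD split: if_splits\<close>)
  ultimately show ?case by simp
qed auto

lemma divdiff_add: "divdiff xs (\<lambda>x. g x + h x) = divdiff xs g + divdiff xs h"
  by (induction xs g rule: divdiff.induct) (simp_all add: add_divide_distrib diff_divide_distrib)

lemma divdiff_cmult: "divdiff xs (\<lambda>x. c * g x) = c * divdiff xs g"
  by (induction xs g rule: divdiff.induct) (simp_all add: right_diff_distrib)

lemma divdiff_zero: "divdiff xs (\<lambda>x. 0) = 0"
  using divdiff_cmult[of xs 0 "\<lambda>x. 0"] by simp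

section \<open>Divided differences as weighted sums over a node set\<close>

definition node_prod :: "real set \<Rightarrow> real \<Rightarrow> real" where
  "node_prod S a = (\<Prod>b\<in>S - {a}. a - b)"

text \<open>For \<open>a\<close> in \<open>S\<close>, \<open>node_prod S a\<close> is the derivative
  at \<open>a\<close> of the monic polynomial with simple roots \<open>S\<close>. No order of the
  nodes enters, so any node may be deleted or inserted.\<close>

definition divdiff_set :: "real set \<Rightarrow> (real \<Rightarrow> real) \<Rightarrow> real" where
  "divdiff_set S g = (\<Sum>a\<in>S. g a / node_prod S a)"

lemma node_prod_nonzero: "finite S \<Longrightarrow> node_prod S a \<noteq> 0"
  by (auto simp: node_prod_def)

lemma node_prod_insert:
  assumes "finite S" "x \<notin> S" "a \<noteq> x"
  shows "node_prod (insert x S) a = (a - x) * node_prod S a"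
proof -
  have "insert x S - {a} = insert x (S - {a})" using assms by auto
  then show ?thesis using assms by (simp add: node_prod_def)
qed

text \<open>The factor \<open>a - x\<close> kills the term at \<open>x\<close> and cancels the
  factor that \<open>x\<close> contributes to every other weight.\<close>

lemma divdiff_set_remove:
  assumes "finite S" "x \<in> S"
  shows "divdiff_set (S - {x}) g = (\<Sum>a\<in>S. (a - x) * g a / node_prod S a)"
proof -
  have "(\<Sum>a\<in>S. (a - x) * g a / node_prod S a)
      = (\<Sum>a\<in>S - {x}. (a - x) * g a / node_prod S a)"
    using assms by (simp add: sum.remove)
  also have "\<dots> = (\<Sum>a\<in>S - {x}. g a / node_prod (S - {x}) a)"
  proof (rule sum.cong)
    fix a assume "a \<in> S - {x}"
    then have "node_prod S a = (a - x) * node_prod (S - {x}) a"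
      using node_prod_insert[of "S - {x}" x a] assms by (simp add: insert_absorb)
    then show "(a - x) * g a / node_prod S a = g a / node_prod (S - {x}) a"
      using \<open>a \<in> S - {x}\<close> by simp
  qed simp
  finally show ?thesis by (simp add: divdiff_set_def)
qed

text \<open>By \<open>divdiff_set_remove\<close> both deletions become sums over \<open>S\<close>,
  and their factors differ by the constant \<open>(a - x) - (a - z) = z - x\<close>.\<close>

lemma divdiff_set_recursion:
  assumes "finite S" "x \<in> S" "z \<in> S" "x \<noteq> z"
  shows "divdiff_set S g = (divdiff_set (S - {x}) g - divdiff_set (S - {z}) g) / (z - x)"
proof -
  have "divdiff_set (S - {x}) g - divdiff_set (S - {z}) g = (z - x) * divdiff_set S g"
    unfolding divdiff_set_remove[OF assms(1,2)] divdiff_set_remove[OF assms(1,3)]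
      divdiff_set_def[of S] sum_distrib_left sum_subtractf[symmetric]
    by (intro sum.cong) (simp_all add: algebra_simps flip: diff_divide_distrib)
  then show ?thesis using assms by simp
qed

text \<open>The list recursion drops the first or the last entry; distinctness turns these into the
  two deletions of \<open>divdiff_set_recursion\<close>.\<close>

lemma divdiff_eq_divdiff_set:
  "distinct xs \<Longrightarrow> xs \<noteq> [] \<Longrightarrow> divdiff xs g = divdiff_set (set xs) g"
proof (induction xs g rule: divdiff.induct)
  case (2 x g)
  show ?case by (simp add: divdiff_set_def node_prod_def)
next
  case (3 x y zs g)
  define xs where "xs = x # y # zs"
  define z where "z = last (y # zs)"
  have z: "z \<in> set (y # zs)" unfolding z_def by (rule last_in_set) simp
  have xz: "x \<noteq> z" using z 3(3) by auto
  have eq: "xs = butlast xs @ [z]" by (simp add: xs_def z_def)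
  have d: "distinct (butlast xs @ [z])" using 3(3) eq by (metis xs_def)
  have sub: "set (butlast xs) = set xs - {z}"
    by (subst (2) eq) (use d in auto)
  have "divdiff (y # zs) g = divdiff_set (set xs - {x}) g"
    using 3(1,3) by (auto simp: xs_def)
  moreover have "divdiff (butlast xs) g = divdiff_set (set xs - {z}) g"
    using 3(2) d sub unfolding xs_def by simp
  ultimately have "divdiff xs g
      = (divdiff_set (set xs - {x}) g - divdiff_set (set xs - {z}) g) / (z - x)"
    by (simp add: xs_def z_def)
  also have "\<dots> = divdiff_set (set xs) g"
    using divdiff_set_recursion[of "set xs" x z g] z xz by (simp add: xs_def)
  finally show ?case by (simp only: xs_def)
qed simp

lemma divdiff_set_const_one:
  assumes "finite S" "1 < card S"
  shows "divdiff_set S (\<lambda>x. 1) = 0"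
  using assms
proof (induction "card S" arbitrary: S rule: less_induct)
  case less
  obtain x z where x: "x \<in> S" and z: "z \<in> S" "z \<noteq> x"
    using less.prems by (metis card_le_Suc0_iff_eq leD One_nat_def)
  have cx: "card (S - {x}) = card S - 1" and cz: "card (S - {z}) = card S - 1"
    using x z less.prems by simp_all
  have "divdiff_set (S - {x}) (\<lambda>x. 1) = divdiff_set (S - {z}) (\<lambda>x. 1)"
  \<comment> \<open>One-point sets fall outside the induction hypothesis, but there both values are
    1; on larger sets both are 0.\<close>
  proof (cases "card S = 2")
    case True
    then obtain a b where "S - {x} = {a}" "S - {z} = {b}"
      using cx cz by (metis card_1_singletonE diff_add_inverse2 one_add_one)
    then show ?thesis by (simp add: divdiff_set_def node_prod_def)
  next
    case False
    then show ?thesis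
      using less.hyps[of "S - {x}"] less.hyps[of "S - {z}"] less.prems cx cz by simp
  qed
  then show ?case
    using divdiff_set_recursion[of S x z "\<lambda>x. 1"] less.prems x z by simp
qed

text \<open>Deleting a node \<open>x\<close> amounts to multiplying the function by
  \<open>a - x\<close>, so the value for \<open>a ^ Suc k\<close> is \<open>x\<close> times the
  value for \<open>a ^ k\<close>, up to a term that vanishes by induction on
  \<open>S - {x}\<close>.\<close>

lemma divdiff_set_power:
  assumes "finite S" "Suc k < card S"
  shows "divdiff_set S (\<lambda>x. x ^ k) = 0"
  using assms
proof (induction k arbitrary: S)
  case 0
  then show ?case using divdiff_set_const_one by simp
next
  case (Suc k)
  obtain x where x: "x \<in> S" using Suc.prems by fastforce
  have "(\<Sum>a\<in>S. (a - x) * a ^ k / node_prod S a) = 0"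
    using divdiff_set_remove[of S x "\<lambda>x. x ^ k"] Suc.IH[of "S - {x}"] Suc.prems x by simp
  then have "divdiff_set S (\<lambda>x. x ^ Suc k) - x * divdiff_set S (\<lambda>x. x ^ k) = 0"
    by (simp add: divdiff_set_def sum_distrib_left left_diff_distrib diff_divide_distrib
        sum_subtractf)
  then show ?case using Suc.IH[of S] Suc.prems by simp
qed

section \<open>Lagrange interpolation with remainder\<close>

definition lagrange_basis :: "real set \<Rightarrow> real \<Rightarrow> real poly" where
  "lagrange_basis N a = smult (1 / node_prod N a) (\<Prod>b\<in>N - {a}. [:- b, 1:])"

lemma poly_lagrange_basis:
  "poly (lagrange_basis N a) x = (\<Prod>b\<in>N - {a}. x - b) / node_prod N a"
  by (simp add: lagrange_basis_def poly_prod)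

lemma degree_lagrange_basis:
  assumes "finite N" "a \<in> N"
  shows "degree (lagrange_basis N a) < card N"
proof -
  have "degree (\<Prod>b\<in>N - {a}. [:- b, 1:]) = card (N - {a})"
    by (subst degree_prod_eq_sum_degree) auto
  moreover have "card (N - {a}) < card N"
    using assms by (intro psubset_card_mono) auto
  ultimately show ?thesis by (auto simp: lagrange_basis_def)
qed

lemma lagrange_interpolation_node:
  assumes "finite N" "x \<in> N"
  shows "(\<Sum>a\<in>N. g a * poly (lagrange_basis N a) x) = g x"
proof -
  have "(\<Sum>a\<in>N - {x}. g a * poly (lagrange_basis N a) x) = 0"
    using assms by (intro sum.neutral) (auto simp: poly_lagrange_basis)
  moreover have "poly (lagrange_basis N x) x = 1"
    using node_prod_nonzero[OF assms(1), of x]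
    by (simp add: poly_lagrange_basis node_prod_def)
  ultimately show ?thesis using assms by (simp add: sum.remove)
qed

text \<open>Solve the weighted sum over \<open>insert x N\<close> for the term at \<open>x\<close>,
  whose weight is the reciprocal of the product of the \<open>x - b\<close>.\<close>

lemma lagrange_interpolation_remainder:
  assumes "finite N" "x \<notin> N"
  shows "g x = (\<Prod>b\<in>N. x - b) * divdiff_set (insert x N) g
    + (\<Sum>a\<in>N. g a * poly (lagrange_basis N a) x)"
proof -
  define w where "w = (\<Prod>b\<in>N. x - b)"
  have w: "w \<noteq> 0" using assms by (auto simp: w_def)
  have nx: "node_prod (insert x N) x = w"
    using assms by (simp add: node_prod_def w_def)
  \<comment> \<open>The minus sign is the quotient \<open>(x - a) / (a - x)\<close>.\<close>
  have "g a * poly (lagrange_basis N a) x = - w * (g a / node_prod (insert x N) a)"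
    if a: "a \<in> N" for a
  proof -
    have "w = (x - a) * (\<Prod>b\<in>N - {a}. x - b)"
      unfolding w_def using assms a by (simp add: prod.remove)
    moreover have "node_prod (insert x N) a = (a - x) * node_prod N a"
      using assms a by (intro node_prod_insert) auto
    moreover have "a \<noteq> x" using assms a by auto
    ultimately show ?thesis
      using node_prod_nonzero[OF assms(1), of a]
      by (simp add: poly_lagrange_basis divide_simps) (simp add: algebra_simps)
  qed
  then have "(\<Sum>a\<in>N. g a * poly (lagrange_basis N a) x)
      = - w * (\<Sum>a\<in>N. g a / node_prod (insert x N) a)"
    by (simp add: sum_distrib_left)
  moreover have "divdiff_set (insert x N) g = g x / w + (\<Sum>a\<in>N. g a / node_prod (insert x N) a)"
    using assms by (simp add: divdiff_set_def nx)
  ultimately show ?thesis using w by (simp add: algebra_simps flip: w_def)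
qed

section \<open>Multiple divided differences\<close>

lemma multi_divdiff_cong_nodes:
  "(\<And>i. i \<in> {1..d} \<Longrightarrow> X i = Y i) \<Longrightarrow> multi_divdiff d X f = multi_divdiff d Y f"
  by (induction d arbitrary: f) auto

lemma PiE_update_Suc:
  assumes "y \<in> PiE {1..d} I" "x \<in> I (Suc d)"
  shows "y(Suc d := x) \<in> PiE {1..Suc d} I"
  using assms by (auto simp: PiE_iff extensional_def le_Suc_eq)

text \<open>All evaluation points have their coordinates among the nodes, so values of the total
  functions off the box are irrelevant.\<close>

lemma multi_divdiff_cong:
  assumes "\<And>i. i \<in> {1..d} \<Longrightarrow> set (X i) \<subseteq> I i"
    and "\<And>y. y \<in> PiE {1..d} I \<Longrightarrow> f y = g y"
  shows "multi_divdiff d X f = multi_divdiff d X g"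
  using assms
proof (induction d arbitrary: f g)
  case 0
  have "(\<lambda>_. undefined) \<in> PiE {1..0} I" by simp
  then show ?case using 0 by simp
next
  case (Suc d)
  have "multi_divdiff d X (\<lambda>y. f (y(Suc d := x))) = multi_divdiff d X (\<lambda>y. g (y(Suc d := x)))"
    if "x \<in> set (X (Suc d))" for x
    using Suc.prems that by (intro Suc.IH Suc.prems(2) PiE_update_Suc) fastforce+
  then show ?case by (simp cong: divdiff_cong)
qed

lemma multi_divdiff_add:
  "multi_divdiff d X (\<lambda>y. f y + g y) = multi_divdiff d X f + multi_divdiff d X g"
  by (induction d arbitrary: f g) (simp_all add: divdiff_add)

lemma multi_divdiff_cmult: "multi_divdiff d X (\<lambda>y. c * f y) = c * multi_divdiff d X f"
  by (induction d arbitrary: f) (simp_all add: divdiff_cmult)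

lemma multi_divdiff_sum:
  "multi_divdiff d X (\<lambda>y. \<Sum>j\<in>J. f j y) = (\<Sum>j\<in>J. multi_divdiff d X (f j))"
proof (induction J rule: infinite_finite_induct)
  case (insert j J)
  then show ?case by (simp add: multi_divdiff_add)
qed (use multi_divdiff_cmult[of d X 0] in simp_all)

text \<open>One coordinate suffices: at level \<open>i\<close> of the recursion \<open>B\<close> is
  a constant factor and the power is annihilated; the levels above only see the zero function. The
  last hypothesis says that \<open>B\<close> ignores coordinate \<open>i\<close>.\<close>

lemma multi_divdiff_power:
  assumes "i \<in> {1..d}" "distinct (X i)" "Suc k < length (X i)"
    and "\<And>y t. B (y(i := t)) = B y"
  shows "multi_divdiff d X (\<lambda>y. B y * y i ^ k) = 0"
  using assms
proof (induction d arbitrary: B)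
  case (Suc d)
  show ?case
  proof (cases "i = Suc d")
    case True
    have "divdiff (X i) (\<lambda>x. x ^ k) = 0"
      using Suc.prems divdiff_eq_divdiff_set[of "X i" "\<lambda>x. x ^ k"]
      by (force simp: divdiff_set_power distinct_card)
    moreover have "multi_divdiff d X (\<lambda>y. B (y(Suc d := x)) * (y(Suc d := x)) i ^ k)
        = multi_divdiff d X B * x ^ k" for x
    proof -
      have "B (y(Suc d := x)) * (y(Suc d := x)) i ^ k = x ^ k * B y" for y
        using Suc.prems(4)[of y x] unfolding True by (simp only: fun_upd_same mult.commute)
      then show ?thesis using multi_divdiff_cmult[of d X "x ^ k" B] by (simp only: mult.commute)
    qed
    ultimately show ?thesis
      using divdiff_cmult[of "X i" "multi_divdiff d X B"] True by simp
  next
    case False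
    \<comment> \<open>Updates at distinct coordinates commute, so fixing the last coordinate
      preserves independence of coordinate \<open>i\<close>.\<close>
    have B: "B (y(i := t, Suc d := x)) = B (y(Suc d := x))" for y t x
      using Suc.prems(4)[of "y(Suc d := x)" t] fun_upd_twist[OF False, of y t x] by (simp only:)
    have "multi_divdiff d X (\<lambda>y. B (y(Suc d := x)) * y i ^ k) = 0" for x
      by (rule Suc.IH[OF _ Suc.prems(2,3) B]) (use Suc.prems(1) False in auto)
    then show ?thesis using False by (simp add: divdiff_zero)
  qed
qed simp

section \<open>Box-affine functions and pseudo-polynomials\<close>

lemma pseudo_polynomial_imp_box_affine:
  assumes "pseudo_polynomial d I (\<lambda>i. int (n i) - 1) f"
  shows "box_affine d I n f"
  unfolding box_affine_def
proof (intro allI impI)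
  fix X assume X: "\<forall>i\<in>{1..d}. length (X i) = n i + 1 \<and> distinct (X i) \<and> set (X i) \<subseteq> I i"
  obtain A where A: "\<And>x. x \<in> PiE {1..d} I \<Longrightarrow>
      f x = (\<Sum>i = 1..d. \<Sum>k | int k \<le> int (n i) - 1. A i k (restrict x ({1..d} - {i})) * x i ^ k)"
    using assms unfolding pseudo_polynomial_def by blast
  have "multi_divdiff d X f = multi_divdiff d X (\<lambda>x.
      \<Sum>i = 1..d. \<Sum>k | int k \<le> int (n i) - 1. A i k (restrict x ({1..d} - {i})) * x i ^ k)"
    by (rule multi_divdiff_cong[where I = I]) (use X A in auto)
  also have "\<dots> = (\<Sum>i = 1..d. \<Sum>k | int k \<le> int (n i) - 1.
      multi_divdiff d X (\<lambda>x. A i k (restrict x ({1..d} - {i})) * x i ^ k))"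
    by (simp add: multi_divdiff_sum)
  also have "\<dots> = 0"
  \<comment> \<open>The exponent satisfies \<open>k < n i\<close> while there are
    \<open>n i + 1\<close> nodes in coordinate \<open>i\<close>, which gives
    \<open>Suc k < length (X i)\<close>.\<close>
  proof (intro sum.neutral ballI multi_divdiff_power)
    fix i y and t :: real
    have "restrict (y(i := t)) ({1..d} - {i}) = restrict y ({1..d} - {i})" by auto
    then show "A i k (restrict (y(i := t)) ({1..d} - {i})) = A i k (restrict y ({1..d} - {i}))"
      for k by simp
  qed (use X in auto)
  finally show "multi_divdiff d X f = 0" .
qed

text \<open>For fixed \<open>S\<close> the operation in the last variable is a finite linear
  combination, so it commutes with \<open>multi_divdiff d X\<close> and supplies the missing
  outermost level.\<close>

lemma box_affine_divdiff_last:
  assumes "box_affine (Suc d) I n f"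
    and "finite S" "S \<subseteq> I (Suc d)" "card S = n (Suc d) + 1"
  shows "box_affine d I n (\<lambda>y. divdiff_set S (\<lambda>a. f (y(Suc d := a))))"
  unfolding box_affine_def
proof (intro allI impI)
  fix X assume X: "\<forall>i\<in>{1..d}. length (X i) = n i + 1 \<and> distinct (X i) \<and> set (X i) \<subseteq> I i"
  obtain xs where xs: "set xs = S" "distinct xs"
    using assms(2) finite_distinct_list by blast
  define Y where "Y = X(Suc d := xs)"
  have len: "length xs = n (Suc d) + 1" using xs assms(4) distinct_card by metis
  have "multi_divdiff d X (\<lambda>y. divdiff_set S (\<lambda>a. f (y(Suc d := a))))
      = divdiff_set S (\<lambda>a. multi_divdiff d X (\<lambda>y. f (y(Suc d := a))))"
    using multi_divdiff_cmult[of d X "1 / node_prod S a" for a]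
    by (simp add: divdiff_set_def multi_divdiff_sum)
  also have "\<dots> = divdiff_set S (\<lambda>a. multi_divdiff d Y (\<lambda>y. f (y(Suc d := a))))"
    unfolding divdiff_set_def
    by (intro sum.cong arg_cong2[where f = "(/)"] multi_divdiff_cong_nodes) (auto simp: Y_def)
  also have "\<dots> = multi_divdiff (Suc d) Y f"
    using divdiff_eq_divdiff_set[of xs] xs len by (force simp: Y_def)
  also have "\<dots> = 0"
  proof -
    have "\<forall>i\<in>{1..Suc d}. length (Y i) = n i + 1 \<and> distinct (Y i) \<and> set (Y i) \<subseteq> I i"
      using X xs len assms(3) by (auto simp: Y_def le_Suc_eq)
    then show ?thesis using assms(1) unfolding box_affine_def by blast
  qed
  finally show "multi_divdiff d X (\<lambda>y. divdiff_set S (\<lambda>a. f (y(Suc d := a)))) = 0" .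
qed

text \<open>The final alternative ensures that adding any further point of \<open>J\<close> gives
  exactly \<open>n + 1\<close> nodes.\<close>

lemma nodes_exist:
  obtains N :: "real set" where "finite N" "N \<subseteq> J" "card N \<le> n" "N = J \<or> card N = n"
proof (cases "finite J \<and> card J \<le> n")
  case False
  then obtain N where "finite N" "N \<subseteq> J" "card N = n"
    by (metis infinite_arbitrarily_large linorder_le_cases obtain_subset_with_card_n)
  then show ?thesis using that by blast
qed (use that in blast)

lemma poly_eq_sum_le:
  fixes p :: "real poly"
  assumes "degree p < n"
  shows "poly p x = (\<Sum>k | int k \<le> int n - 1. coeff p k * x ^ k)"
proof -
  have "finite {k. k < n}" "{..degree p} \<subseteq> {k. k < n}" using assms by auto
  moreover have "{k. int k \<le> int n - 1} = {k. k < n}" by auto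
  ultimately show ?thesis
    by (auto simp: poly_altdef coeff_eq_0 intro!: sum.mono_neutral_left)
qed

lemma box_affine_imp_pseudo_polynomial:
  "box_affine d I n f \<Longrightarrow> pseudo_polynomial d I (\<lambda>i. int (n i) - 1) f"
proof (induction d arbitrary: f)
  \<comment> \<open>With no coordinates the condition on the nodes is vacuous, so \<open>f\<close>
    vanishes at the only point, in agreement with the empty sum.\<close>
  case 0
  then show ?case by (auto simp: box_affine_def pseudo_polynomial_def)
next
  case (Suc d)
  obtain N where N: "finite N" "N \<subseteq> I (Suc d)" "card N \<le> n (Suc d)"
      "N = I (Suc d) \<or> card N = n (Suc d)"
    by (rule nodes_exist)
  define F where "F t y = divdiff_set (insert t N) (\<lambda>a. f (y(Suc d := a)))" for t y
  \<comment> \<open>Such a \<open>t\<close> rules out \<open>N = I (Suc d)\<close>, so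
    \<open>insert t N\<close> has \<open>n (Suc d) + 1\<close> points.\<close>
  have "pseudo_polynomial d I (\<lambda>i. int (n i) - 1) (F t)" if "t \<in> I (Suc d) - N" for t
    unfolding F_def using that N by (intro Suc.IH box_affine_divdiff_last Suc.prems) auto
  then have "\<exists>A. \<forall>t\<in>I (Suc d) - N. \<forall>x \<in> PiE {1..d} I. F t x =
      (\<Sum>i = 1..d. \<Sum>k | int k \<le> int (n i) - 1. A t i k (restrict x ({1..d} - {i})) * x i ^ k)"
    unfolding pseudo_polynomial_def by (intro bchoice ballI)
  then obtain A where A: "\<And>t x. t \<in> I (Suc d) - N \<Longrightarrow> x \<in> PiE {1..d} I \<Longrightarrow> F t x =
      (\<Sum>i = 1..d. \<Sum>k | int k \<le> int (n i) - 1. A t i k (restrict x ({1..d} - {i})) * x i ^ k)"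
    by blast
  \<comment> \<open>For \<open>i = Suc d\<close> these are the coefficients of the interpolant.
    Otherwise \<open>z\<close> still carries the last coordinate \<open>t\<close>, which selects
    \<open>A t\<close>; resetting it to \<open>undefined\<close> gives the
    \<open>d\<close>-dimensional restriction that \<open>A\<close> expects.\<close>
  define B where "B i k z = (if i = Suc d
      then \<Sum>a\<in>N. f (z(Suc d := a)) * coeff (lagrange_basis N a) k
      else (\<Prod>b\<in>N. z (Suc d) - b) * A (z (Suc d)) i k (z(Suc d := undefined)))" for i k z
  have "f x = (\<Sum>i = 1..Suc d. \<Sum>k | int k \<le> int (n i) - 1.
      B i k (restrict x ({1..Suc d} - {i})) * x i ^ k)" if x: "x \<in> PiE {1..Suc d} I" for x
  proof -
    define t where "t = x (Suc d)"
    define y where "y = restrict x {1..d}"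
    have t: "t \<in> I (Suc d)" and y: "y \<in> PiE {1..d} I" using x by (auto simp: t_def y_def)
    have xy: "x = y(Suc d := t)"
      using x by (auto simp: t_def y_def fun_eq_iff PiE_iff extensional_def le_Suc_eq)
    have restrict_last: "restrict x ({1..Suc d} - {Suc d}) = y"
      by (auto simp: y_def fun_eq_iff)
    have restrict_other: "restrict x ({1..Suc d} - {i}) = (restrict y ({1..d} - {i}))(Suc d := t)"
      if "i \<in> {1..d}" for i
      using that by (auto simp: y_def t_def fun_eq_iff)
    have "(\<Sum>i = 1..d. \<Sum>k | int k \<le> int (n i) - 1. B i k (restrict x ({1..Suc d} - {i})) * x i ^ k)
        = (\<Sum>i = 1..d. \<Sum>k | int k \<le> int (n i) - 1.
            (\<Prod>b\<in>N. t - b) * (A t i k (restrict y ({1..d} - {i})) * y i ^ k))"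
    proof (intro sum.cong)
      fix i k assume i: "i \<in> {1..d}"
      have "(restrict y ({1..d} - {i}))(Suc d := undefined) = restrict y ({1..d} - {i})"
        by (auto simp: fun_eq_iff)
      then show "B i k (restrict x ({1..Suc d} - {i})) * x i ^ k
          = (\<Prod>b\<in>N. t - b) * (A t i k (restrict y ({1..d} - {i})) * y i ^ k)"
        using i unfolding restrict_other[OF i] B_def fun_upd_upd fun_upd_same by (simp add: xy)
    qed auto
    also have "\<dots> = (\<Prod>b\<in>N. t - b) * F t y"
    \<comment> \<open>At a node nothing is known about \<open>A t\<close>, but the product of the
      \<open>t - b\<close> vanishes on both sides.\<close>
    proof (cases "t \<in> N")
      case True
      then have "(\<Prod>b\<in>N. t - b) = 0" using N by auto
      then show ?thesis by simp
    next
      case False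
      then show ?thesis using A[of t y] t y by (simp add: sum_distrib_left)
    qed
    finally have *: "(\<Sum>i = 1..d. \<Sum>k | int k \<le> int (n i) - 1.
        B i k (restrict x ({1..Suc d} - {i})) * x i ^ k) = (\<Prod>b\<in>N. t - b) * F t y" .
    \<comment> \<open>Interchanging the sums over powers and nodes collects the coefficients into
      the basis polynomials.\<close>
    have "(\<Sum>k | int k \<le> int (n (Suc d)) - 1.
          B (Suc d) k (restrict x ({1..Suc d} - {Suc d})) * x (Suc d) ^ k)
        = (\<Sum>a\<in>N. f (y(Suc d := a)) *
            (\<Sum>k | int k \<le> int (n (Suc d)) - 1. coeff (lagrange_basis N a) k * t ^ k))"
      unfolding restrict_last
      by (simp add: B_def t_def sum_distrib_left sum_distrib_right mult.assoc)
         (rule sum.swap)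
    also have "\<dots> = (\<Sum>a\<in>N. f (y(Suc d := a)) * poly (lagrange_basis N a) t)"
    proof (rule sum.cong)
      fix a assume "a \<in> N"
      then have "degree (lagrange_basis N a) < n (Suc d)"
        using degree_lagrange_basis N by (meson less_le_trans)
      from poly_eq_sum_le[OF this] show "f (y(Suc d := a)) *
            (\<Sum>k | int k \<le> int (n (Suc d)) - 1. coeff (lagrange_basis N a) k * t ^ k)
          = f (y(Suc d := a)) * poly (lagrange_basis N a) t" by simp
    qed simp
    finally have **: "(\<Sum>k | int k \<le> int (n (Suc d)) - 1.
          B (Suc d) k (restrict x ({1..Suc d} - {Suc d})) * x (Suc d) ^ k)
        = (\<Sum>a\<in>N. f (y(Suc d := a)) * poly (lagrange_basis N a) t)" .
    \<comment> \<open>At a node the interpolant is exact; elsewhere the remainder formula applies in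
      the last variable.\<close>
    have "f x = (\<Prod>b\<in>N. t - b) * F t y + (\<Sum>a\<in>N. f (y(Suc d := a)) * poly (lagrange_basis N a) t)"
    proof (cases "t \<in> N")
      case True
      then have "(\<Prod>b\<in>N. t - b) = 0" using N by auto
      then show ?thesis
        using lagrange_interpolation_node[OF N(1) True, of "\<lambda>a. f (y(Suc d := a))"] xy by simp
    next
      case False
      then show ?thesis
        using lagrange_interpolation_remainder[OF N(1) False, of "\<lambda>a. f (y(Suc d := a))"] xy
        by (simp add: F_def)
    qed
    then show ?thesis using * ** by simp
  qed
  then show ?case unfolding pseudo_polynomial_def by blast
qed

theorem theorem12:
  fixes d :: nat and I :: "nat \<Rightarrow> real set" and n :: "nat \<Rightarrow> nat"
    and f :: "(nat \<Rightarrow> real) \<Rightarrow> real"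
  assumes "d \<ge> 1"
    and "\<And>i. i \<in> {1..d} \<Longrightarrow> is_interval (I i)"
  shows "box_affine d I n f \<longleftrightarrow> pseudo_polynomial d I (\<lambda>i. int (n i) - 1) f"
  using box_affine_imp_pseudo_polynomial pseudo_polynomial_imp_box_affine by blast

end
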